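(* Let $f:X\to Y$ be a morphism of directed graphs. Then $f$ belongs to $W$ (that is, for every $n\ge 0$ the map $\mathrm{Hom}(c_n,X)\to \mathrm{Hom}(c_n,Y)$, $g\mapsto f\circ g$, is bijective) if and only if $f$ induces a bijection between the set of strongly connected components of $X$ and the set of strongly connected components of $Y$, and the restriction of $f$ to each strongly connected component of $X$ is an isomorphism onto a strongly connected component of $Y$.
   Context: A directed graph $X$ consists of a set $X(0)$ of nodes, a set $X(1)$ of arcs, and two maps $s,t:X(1)\to X(0)$ (source and target); loops and parallel arcs are allowed and $X$ may be infinite. A morphism $f:X\to Y$ is a pair of maps $f(0):X(0)\to Y(0)$, $f(1):X(1)\to Y(1)$ commuting with $s$ and $t$. The category of directed graphs is denoted $Gph$. For $n\ge 1$, $c_n$ is the directed cycle with $n$ nodes $x_0,\dots,x_{n-1}$ and $n$ arcs $a_0,\dots,a_{n-1}$, where $a_i$ goes from $x_i$ to $x_{i+1}$ (indices mod $n$). $c_0=D$ is the graph with one node and no arc. A cycle of $X$ is a morphism $c_n\to X$. Strongly connected components: define an equivalence relation $R$ on $X(0)$ by $xRx$ for all $x$, and, for $x\ne y$, $xRy$ iff there is a cycle of $X$ whose image contains $x$ and $y$. For an equivalence class $U$, $X_U$ is the subgraph of $X$ with node set $U$ and whose arcs are all arcs of $X$ with both source and target in $U$. The graphs $X_U$ are the strongly connected components of $X$. (A morphism $f$ sends each strongly connected component of $X$ into a unique strongly connected component of $Y$; this is the induced map on sets of components.) *)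

theory Defs
  imports "Graph_Theory.Digraph_Component" "HOL-Library.FuncSet"
begin

text \<open>
  Directed graphs are those of the entry Graph_Theory: \<^typ>\<open>('a, 'b) pre_digraph\<close> records satisfying
  \<^locale>\<open>wf_digraph\<close>, with \<^const>\<open>tail\<close> as source and \<^const>\<open>head\<close> as target. Morphisms are pairs
  of extensional functions, so that two morphisms with the same source are equal as terms iff they
  agree on all nodes and arcs, and sets of morphisms are the Hom-sets of the category.
\<close>

type_synonym ('a, 'b, 'c, 'd) gph_map = "('a \<Rightarrow> 'c) \<times> ('b \<Rightarrow> 'd)"

definition gph_hom ::
    "('a, 'b) pre_digraph \<Rightarrow> ('c, 'd) pre_digraph \<Rightarrow> ('a, 'b, 'c, 'd) gph_map set" where
  "gph_hom X Y =
    {f. fst f \<in> verts X \<rightarrow>\<^sub>E verts Y \<and> snd f \<in> arcs X \<rightarrow>\<^sub>E arcs Y \<and>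
        (\<forall>a \<in> arcs X. tail Y (snd f a) = fst f (tail X a) \<and> head Y (snd f a) = fst f (head X a))}"

text \<open>The first argument of \<open>gph_comp\<close> is the source of \<open>g\<close>.\<close>

definition gph_comp ::
    "('a, 'b) pre_digraph \<Rightarrow> ('c, 'd, 'e, 'f) gph_map \<Rightarrow> ('a, 'b, 'c, 'd) gph_map
      \<Rightarrow> ('a, 'b, 'e, 'f) gph_map" where
  "gph_comp X f g = (compose (verts X) (fst f) (fst g), compose (arcs X) (snd f) (snd g))"

definition gph_id :: "('a, 'b) pre_digraph \<Rightarrow> ('a, 'b, 'a, 'b) gph_map" where
  "gph_id X = (\<lambda>x \<in> verts X. x, \<lambda>a \<in> arcs X. a)"

definition gph_iso ::
    "('a, 'b) pre_digraph \<Rightarrow> ('c, 'd) pre_digraph \<Rightarrow> ('a, 'b, 'c, 'd) gph_map \<Rightarrow> bool" where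
  "gph_iso X Y f \<longleftrightarrow> f \<in> gph_hom X Y \<and>
    (\<exists>g \<in> gph_hom Y X. gph_comp X g f = gph_id X \<and> gph_comp Y f g = gph_id Y)"

definition gph_restrict ::
    "('a, 'b, 'c, 'd) gph_map \<Rightarrow> ('a, 'b) pre_digraph \<Rightarrow> ('a, 'b, 'c, 'd) gph_map" where
  "gph_restrict f C = (restrict (fst f) (verts C), restrict (snd f) (arcs C))"

text \<open>For \<open>n = 0\<close> this is the graph with one node and no arc.\<close>

definition cycle_graph :: "nat \<Rightarrow> (nat, nat) pre_digraph" where
  "cycle_graph n =
    \<lparr> verts = (if n = 0 then {0} else {..<n}), arcs = {..<n},
      tail = (\<lambda>i. i), head = (\<lambda>i. (i + 1) mod n) \<rparr>"

definition class_W ::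
    "('a, 'b) pre_digraph \<Rightarrow> ('c, 'd) pre_digraph \<Rightarrow> ('a, 'b, 'c, 'd) gph_map set" where
  "class_W X Y = {f \<in> gph_hom X Y.
    \<forall>n. bij_betw (gph_comp (cycle_graph n) f)
          (gph_hom (cycle_graph n) X) (gph_hom (cycle_graph n) Y)}"

definition scc_rel :: "('a, 'b) pre_digraph \<Rightarrow> 'a rel" where
  "scc_rel X = {(x, y). x \<in> verts X \<and> y \<in> verts X \<and>
    (x = y \<or> (\<exists>n. \<exists>c \<in> gph_hom (cycle_graph n) X.
                {x, y} \<subseteq> fst c ` verts (cycle_graph n)))}"

text \<open>
  Defined through cycles instead of \<^const>\<open>pre_digraph.sccs\<close>, which is based on reachability.
\<close>

definition strong_components :: "('a, 'b) pre_digraph \<Rightarrow> ('a, 'b) pre_digraph set" where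
  "strong_components X = {X \<restriction> U | U. U \<in> verts X // scc_rel X}"

text \<open>
  A morphism \<open>f\<close> to \<open>Y\<close> sends a strongly connected component \<open>C\<close> of its source into exactly one
  strongly connected component of \<open>Y\<close>, so the description below is then proper.
\<close>

definition component_map ::
    "('c, 'd) pre_digraph \<Rightarrow> ('a, 'b, 'c, 'd) gph_map
      \<Rightarrow> ('a, 'b) pre_digraph \<Rightarrow> ('c, 'd) pre_digraph" where
  "component_map Y f C = (THE D. D \<in> strong_components Y \<and>
    fst f ` verts C \<subseteq> verts D \<and> snd f ` arcs C \<subseteq> arcs D)"

end

theory Submission
  imports Defs
begin

text \<open>
  Every arc of a cycle joins two nodes of one strongly connected component, and conversely every
  such arc occurs as the first arc of some cycle; call these arcs cyclic. Both sides of the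
  equivalence say that \<open>f\<close> is bijective on nodes and on cyclic arcs. From \<open>f \<in> W\<close>, nodes are the
  morphisms from \<open>c\<^sub>0\<close>; a cyclic arc of the target is hit by lifting a cycle through it; and if two
  cyclic arcs have the same image, exchanging one for the other in a cycle does not change the
  image of the cycle, so they are equal. Cycles of the target can be lifted, so \<open>f\<close> also reflects
  the relation of lying in one component.
\<close>

definition cyclic_arcs :: "('a, 'b) pre_digraph \<Rightarrow> 'b set" where
  "cyclic_arcs X = {a \<in> arcs X. (tail X a, head X a) \<in> scc_rel X}"

text \<open>Indexed by a node instead of a class, so that statements about components become
  statements about nodes. In a well-formed graph, nodes related by \<open>scc_rel\<close> index the
  same component.\<close>

definition component :: "('a, 'b) pre_digraph \<Rightarrow> 'a \<Rightarrow> ('a, 'b) pre_digraph" where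
  "component X x = X \<restriction> (scc_rel X `` {x})"

text \<open>The morphism from \<open>cycle_graph 0\<close> that picks out the node \<open>x\<close>;
  its arc part is the only extensional function on the empty set.\<close>

definition point :: "'a \<Rightarrow> (nat, nat, 'a, 'b) gph_map" where
  "point x = (\<lambda>i\<in>{0}. x, \<lambda>i\<in>{}. undefined)"

section \<open>Morphisms, composition and isomorphisms\<close>

lemma gph_homD:
  assumes "f \<in> gph_hom X Y"
  shows "x \<in> verts X \<Longrightarrow> fst f x \<in> verts Y" and "a \<in> arcs X \<Longrightarrow> snd f a \<in> arcs Y"
    and "a \<in> arcs X \<Longrightarrow> tail Y (snd f a) = fst f (tail X a)"
    and "a \<in> arcs X \<Longrightarrow> head Y (snd f a) = fst f (head X a)"
  using assms by (auto simp: gph_hom_def)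

lemma gph_comp_hom:
  assumes "wf_digraph X" "g \<in> gph_hom X Y" "f \<in> gph_hom Y Z"
  shows "gph_comp X f g \<in> gph_hom X Z"
proof -
  have "tail X a \<in> verts X" "head X a \<in> verts X" if "a \<in> arcs X" for a
    using assms(1) that by (auto simp: wf_digraph.wellformed)
  then show ?thesis
    using gph_homD[OF assms(2)] gph_homD[OF assms(3)]
    by (auto simp: gph_hom_def gph_comp_def compose_def)
qed

text \<open>The inverse maps of a bijective morphism respect source and target automatically, so
  bijectivity of the two maps can be checked separately.\<close>

lemma gph_iso_iff:
  assumes C: "wf_digraph C" and h: "h \<in> gph_hom C D"
  shows "gph_iso C D h \<longleftrightarrow>
    bij_betw (fst h) (verts C) (verts D) \<and> bij_betw (snd h) (arcs C) (arcs D)"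
proof
  assume "gph_iso C D h"
  then obtain g where g: "g \<in> gph_hom D C" "gph_comp C g h = gph_id C" "gph_comp D h g = gph_id D"
    by (auto simp: gph_iso_def)
  have "fst g (fst h x) = x" if "x \<in> verts C" for x
    using arg_cong[OF g(2), of "\<lambda>k. fst k x"] that by (simp add: gph_comp_def gph_id_def compose_def)
  moreover have "snd g (snd h x) = x" if "x \<in> arcs C" for x
    using arg_cong[OF g(2), of "\<lambda>k. snd k x"] that by (simp add: gph_comp_def gph_id_def compose_def)
  moreover have "fst h (fst g x) = x" if "x \<in> verts D" for x
    using arg_cong[OF g(3), of "\<lambda>k. fst k x"] that by (simp add: gph_comp_def gph_id_def compose_def)
  moreover have "snd h (snd g x) = x" if "x \<in> arcs D" for x
    using arg_cong[OF g(3), of "\<lambda>k. snd k x"] that by (simp add: gph_comp_def gph_id_def compose_def)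
  ultimately show "bij_betw (fst h) (verts C) (verts D) \<and> bij_betw (snd h) (arcs C) (arcs D)"
    using gph_homD[OF h] gph_homD[OF g(1)]
    by (intro conjI bij_betw_byWitness[where f' = "fst g"] bij_betw_byWitness[where f' = "snd g"]) auto
next
  assume "bij_betw (fst h) (verts C) (verts D) \<and> bij_betw (snd h) (arcs C) (arcs D)"
  then have V: "bij_betw (fst h) (verts C) (verts D)" and A: "bij_betw (snd h) (arcs C) (arcs D)"
    by auto
  \<comment> \<open>Restricting the inverse maps makes them extensional, as membership in
    \<open>gph_hom D C\<close> demands.\<close>
  define g where "g = (\<lambda>y\<in>verts D. inv_into (verts C) (fst h) y, \<lambda>b\<in>arcs D. inv_into (arcs C) (snd h) b)"
  have gV: "fst g (fst h x) = x" if "x \<in> verts C" for x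
    using V that gph_homD(1)[OF h] by (simp add: g_def bij_betw_inv_into_left)
  have gA: "snd g (snd h a) = a" if "a \<in> arcs C" for a
    using A that gph_homD(2)[OF h] by (simp add: g_def bij_betw_inv_into_left)
  have hV: "fst g y \<in> verts C" "fst h (fst g y) = y" if "y \<in> verts D" for y
    using V that by (auto simp: g_def bij_betw_def inv_into_into f_inv_into_f)
  have hA: "snd g b \<in> arcs C" "snd h (snd g b) = b" if "b \<in> arcs D" for b
    using A that by (auto simp: g_def bij_betw_def inv_into_into f_inv_into_f)
  have "tail C (snd g b) = fst g (tail D b) \<and> head C (snd g b) = fst g (head D b)"
    if b: "b \<in> arcs D" for b
  proof -
    \<comment> \<open>The ends of \<open>b\<close> are the images of the ends of
      \<open>snd g b\<close>. The latter are nodes of the well-formed graph \<open>C\<close>, so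
      \<open>fst g\<close> sends the former back to them.\<close>
    have a: "snd g b \<in> arcs C" and "snd h (snd g b) = b" using hA b by auto
    then have "tail D b = fst h (tail C (snd g b))" "head D b = fst h (head C (snd g b))"
      using gph_homD(3,4)[OF h a] by auto
    then show ?thesis using C a gV by (simp add: wf_digraph.wellformed)
  qed
  then have "g \<in> gph_hom D C"
    using hV hA by (auto simp: gph_hom_def) (auto simp: g_def)
  moreover have "gph_comp C g h = gph_id C" "gph_comp D h g = gph_id D"
    using gV gA hV hA by (auto simp: gph_comp_def gph_id_def compose_def restrict_def fun_eq_iff)
  ultimately show "gph_iso C D h" using h by (auto simp: gph_iso_def)
qed

section \<open>Morphisms from cycle graphs and the component relation\<close>

lemma wf_cycle_graph: "wf_digraph (cycle_graph n)"
  by unfold_locales (auto simp: cycle_graph_def)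

lemma cycle_hom_iff:
  assumes "0 < n"
  shows "c \<in> gph_hom (cycle_graph n) X \<longleftrightarrow>
    fst c \<in> {..<n} \<rightarrow>\<^sub>E verts X \<and> snd c \<in> {..<n} \<rightarrow>\<^sub>E arcs X \<and>
    (\<forall>i<n. tail X (snd c i) = fst c i \<and> head X (snd c i) = fst c (Suc i mod n))"
  using assms by (auto simp: gph_hom_def cycle_graph_def)

lemma gph_hom_cycle_graph_0: "gph_hom (cycle_graph 0) X = point ` verts X"
proof
  show "gph_hom (cycle_graph 0) X \<subseteq> point ` verts X"
  proof
    fix c :: "(nat, nat, 'a, 'b) gph_map"
    assume c: "c \<in> gph_hom (cycle_graph 0) X"
    then have "c = point (fst c 0)"
      by (intro prod_eqI) (auto simp: gph_hom_def cycle_graph_def point_def fun_eq_iff restrict_def PiE_def extensional_def)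
    moreover have "fst c 0 \<in> verts X"
      using gph_homD(1)[OF c] by (simp add: cycle_graph_def)
    ultimately show "c \<in> point ` verts X" by blast
  qed
qed (auto simp: gph_hom_def cycle_graph_def point_def split: if_splits)

lemma gph_comp_point: "gph_comp (cycle_graph 0) f (point x) = point (fst f x)"
  by (auto simp: gph_comp_def cycle_graph_def point_def compose_def restrict_def fun_eq_iff)

lemma point_eq_iff: "(point x :: (nat, nat, 'a, 'b) gph_map) = point y \<longleftrightarrow> x = y"
  by (auto simp: point_def restrict_def fun_eq_iff)

text \<open>The graph \<open>cycle_graph 0\<close> has a single node, so it relates a node only to
  itself; this is absorbed by \<open>x = y\<close>, and positive \<open>n\<close> allows indices
  below \<open>n\<close>.\<close>

lemma scc_rel_iff:
  "(x, y) \<in> scc_rel X \<longleftrightarrow> x \<in> verts X \<and> y \<in> verts X \<and>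
    (x = y \<or> (\<exists>n>0. \<exists>c \<in> gph_hom (cycle_graph n) X. \<exists>i<n. \<exists>j<n. x = fst c i \<and> y = fst c j))"
proof -
  have "(\<exists>c \<in> gph_hom (cycle_graph n) X. {x, y} \<subseteq> fst c ` verts (cycle_graph n)) \<longleftrightarrow>
      (\<exists>c \<in> gph_hom (cycle_graph n) X. \<exists>i<n. \<exists>j<n. x = fst c i \<and> y = fst c j)"
    if "0 < n" for n
    using that by (auto simp: cycle_graph_def image_iff)
  moreover have "x = y" if "{x, y} \<subseteq> fst c ` verts (cycle_graph 0)"
    for c :: "(nat, nat, 'a, 'b) gph_map"
    using that by (auto simp: cycle_graph_def)
  ultimately show ?thesis
    unfolding scc_rel_def mem_Collect_eq prod.case by (metis gr0I)
qed

lemma scc_rel_in_verts: "(x, y) \<in> scc_rel X \<Longrightarrow> x \<in> verts X \<and> y \<in> verts X"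
  by (simp add: scc_rel_iff)

text \<open>A cycle through both nodes, composed with \<open>f\<close>, is a cycle through their
  images.\<close>

lemma scc_rel_hom:
  assumes f: "f \<in> gph_hom X Y" and "(x, y) \<in> scc_rel X"
  shows "(fst f x, fst f y) \<in> scc_rel Y"
proof (cases "x = y")
  case True
  then show ?thesis using assms by (auto simp: scc_rel_iff gph_homD)
next
  case False
  then obtain n c i j where c: "c \<in> gph_hom (cycle_graph n) X"
    and ij: "i < n" "j < n" "x = fst c i" "y = fst c j"
    using assms(2) by (auto simp: scc_rel_iff)
  have "gph_comp (cycle_graph n) f c \<in> gph_hom (cycle_graph n) Y"
    using wf_cycle_graph c f by (rule gph_comp_hom)
  moreover have "fst (gph_comp (cycle_graph n) f c) k = fst f (fst c k)" if "k < n" for k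
    using that by (auto simp: gph_comp_def cycle_graph_def compose_def)
  moreover have "fst f x \<in> verts Y" "fst f y \<in> verts Y"
    using assms by (auto simp: scc_rel_iff gph_homD)
  ultimately show ?thesis
    unfolding scc_rel_iff using ij by (metis gr0I not_less_zero)
qed

section \<open>Closed walks, reachability and strongly connected components\<close>

context wf_digraph
begin

text \<open>Morphisms from a cycle graph are indexed by position, while \<open>cas\<close> recurses
  along the list; this is the positional form, with the last arc ending in \<open>v\<close>.\<close>

lemma cas_nth:
  assumes "cas u p v" "i < length p"
  shows "head G (p ! i) = (if Suc i < length p then tail G (p ! Suc i) else v)"
  using assms
proof (induction p arbitrary: u i)
  case (Cons a p)
  then show ?case by (cases i; cases p) auto
qed simp

text \<open>Node \<open>i\<close> goes to the source of the \<open>i\<close>-th arc. Consecutive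
  arcs fit together because \<open>p\<close> is a walk, and the last fits the first because the walk
  is closed. Repeated nodes or arcs are harmless, since a cycle is any morphism.\<close>

lemma closed_awalk_cycle_hom:
  assumes p: "awalk u p u" "p \<noteq> []"
  shows "(\<lambda>i\<in>{..<length p}. tail G (p ! i), \<lambda>i\<in>{..<length p}. p ! i)
    \<in> gph_hom (cycle_graph (length p)) G"
proof -
  have arcs: "p ! i \<in> arcs G" if "i < length p" for i
    using p that by (auto simp: awalk_def)
  have "tail G (p ! 0) = u" using p by (cases p) (auto simp: awalk_def)
  \<comment> \<open>At the last position the index wraps to 0, and the head \<open>u\<close> of the
    last arc is the tail of the first.\<close>
  then have "head G (p ! i) = tail G (p ! (Suc i mod length p))" if "i < length p" for i
    using that p cas_nth[of u p u i]
    by (cases "Suc i = length p") (auto simp: awalk_def)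
  then show ?thesis using p arcs by (auto simp: cycle_hom_iff wellformed)
qed

text \<open>Following the arcs of the cycle forward from position \<open>i\<close> eventually
  reaches every position.\<close>

lemma cycle_hom_reachable:
  assumes c: "c \<in> gph_hom (cycle_graph n) G" and "i < n" "j < n"
  shows "fst c i \<rightarrow>\<^sup>* fst c j"
proof -
  have n: "0 < n" using assms by simp
  have step: "fst c k \<rightarrow> fst c (Suc k mod n)" if "k < n" for k
  proof -
    have "snd c k \<in> arcs G" "tail G (snd c k) = fst c k" "head G (snd c k) = fst c (Suc k mod n)"
      using c that by (auto simp: cycle_hom_iff[OF n])
    then show ?thesis by (metis in_arcs_imp_in_arcs_ends)
  qed
  have "fst c i \<rightarrow>\<^sup>* fst c ((i + k) mod n)" for k
  proof (induction k)
    case 0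
    then show ?case using c \<open>i < n\<close> by (auto simp: cycle_hom_iff[OF n])
  next
    case (Suc k)
    have "fst c ((i + k) mod n) \<rightarrow> fst c (Suc ((i + k) mod n) mod n)"
      using step n by simp
    then show ?case using Suc by (metis reachable_adj_trans mod_Suc_eq add_Suc_right)
  qed
  \<comment> \<open>Going first to the end of the cycle and then \<open>j\<close> steps further
    reaches position \<open>j\<close> also when \<open>j < i\<close>.\<close>
  from this[of "n - i + j"] show ?thesis using assms by simp
qed

text \<open>Walks in both directions concatenate to a closed walk, hence to a cycle, which need not
  be injective. This makes transitivity of \<open>scc_rel\<close> a matter of composing
  walks.\<close>

lemma scc_rel_eq_reachable: "(x, y) \<in> scc_rel G \<longleftrightarrow> x \<rightarrow>\<^sup>* y \<and> y \<rightarrow>\<^sup>* x"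
proof
  assume "(x, y) \<in> scc_rel G"
  then show "x \<rightarrow>\<^sup>* y \<and> y \<rightarrow>\<^sup>* x"
    by (auto simp: scc_rel_iff intro: cycle_hom_reachable)
next
  assume xy: "x \<rightarrow>\<^sup>* y \<and> y \<rightarrow>\<^sup>* x"
  then have V: "x \<in> verts G" "y \<in> verts G" by (auto dest: reachable_in_verts)
  show "(x, y) \<in> scc_rel G"
  proof (cases "x = y")
    case True
    then show ?thesis using V by (simp add: scc_rel_iff)
  next
    case False
    obtain p q where pq: "awalk x p y" "awalk y q x"
      using xy by (auto simp: reachable_awalk)
    with False have ne: "p \<noteq> []" "q \<noteq> []" by (auto simp: awalk_def)
    let ?c = "(\<lambda>i\<in>{..<length (p @ q)}. tail G ((p @ q) ! i), \<lambda>i\<in>{..<length (p @ q)}. (p @ q) ! i)"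
    have "awalk x (p @ q) x" using pq by (rule awalk_appendI)
    then have c: "?c \<in> gph_hom (cycle_graph (length (p @ q))) G"
      using ne by (intro closed_awalk_cycle_hom) auto
    \<comment> \<open>The second walk starts in \<open>y\<close> at position
      \<open>length p\<close>, a valid index because \<open>q\<close> is nonempty.\<close>
    have "fst ?c 0 = x" "fst ?c (length p) = y"
      using pq ne by (cases p; cases q; auto simp: awalk_def nth_append)+
    then show ?thesis
      unfolding scc_rel_iff using V c ne
      by (intro conjI disjI2 exI[of _ "length (p @ q)"] bexI[OF _ c] exI[of _ 0] exI[of _ "length p"]) auto
  qed
qed

lemma equiv_scc_rel: "equiv (verts G) (scc_rel G)"
proof (rule equivI)
  show "scc_rel G \<subseteq> verts G \<times> verts G" by (auto simp: scc_rel_iff)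
  show "refl_on (verts G) (scc_rel G)" by (auto simp: refl_on_def scc_rel_iff)
  show "sym (scc_rel G)" by (auto simp: sym_def scc_rel_eq_reachable)
  show "trans (scc_rel G)" by (auto simp: trans_def scc_rel_eq_reachable intro: reachable_trans)
qed

text \<open>A walk from the head back to the tail closes the arc up to a cycle; for a loop this walk
  may be empty. The arc sits at index 0, where it can be exchanged or recovered from a lift.\<close>

lemma cyclic_arc_in_cycle:
  assumes a: "a \<in> cyclic_arcs G"
  obtains n c where "0 < n" "c \<in> gph_hom (cycle_graph n) G" "snd c 0 = a"
proof -
  have "head G a \<rightarrow>\<^sup>* tail G a" using a by (auto simp: cyclic_arcs_def scc_rel_eq_reachable)
  then obtain q where "awalk (head G a) q (tail G a)" by (auto simp: reachable_awalk)
  then have "awalk (tail G a) (a # q) (tail G a)"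
    using a by (auto simp: awalk_Cons_iff cyclic_arcs_def)
  from that[OF _ closed_awalk_cycle_hom[OF this]] show thesis by simp
qed

lemma cycle_hom_cyclic_arcs:
  assumes c: "c \<in> gph_hom (cycle_graph n) G" and i: "i < n"
  shows "snd c i \<in> cyclic_arcs G"
proof -
  have n: "0 < n" using i by simp
  then have j: "Suc i mod n < n" by simp
  show ?thesis
    using c i cycle_hom_reachable[OF c i j] cycle_hom_reachable[OF c j i]
    by (auto simp: cycle_hom_iff[OF n] cyclic_arcs_def scc_rel_eq_reachable)
qed

lemma strong_components_eq: "strong_components G = component G ` verts G"
  by (auto simp: strong_components_def component_def quotient_def)

text \<open>An induced subgraph determines its node set, so equality of components is equality of
  equivalence classes.\<close>

lemma component_eq_iff:
  assumes "x \<in> verts G" "y \<in> verts G"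
  shows "component G x = component G y \<longleftrightarrow> (x, y) \<in> scc_rel G"
proof -
  have "component G x = component G y \<longleftrightarrow> scc_rel G `` {x} = scc_rel G `` {y}"
    unfolding component_def by (metis induce_subgraph_verts)
  then show ?thesis using eq_equiv_class_iff[OF equiv_scc_rel assms] by simp
qed

lemma verts_component: "verts (component G x) = {y. (x, y) \<in> scc_rel G}"
  by (auto simp: component_def)

text \<open>By symmetry and transitivity, an arc with both ends in one class is cyclic, and the head
  of a cyclic arc lies in the class of its tail. Thus the tail alone assigns each cyclic arc to a
  component.\<close>

lemma arcs_component: "arcs (component G x) = {a \<in> cyclic_arcs G. (x, tail G a) \<in> scc_rel G}"
  using equiv_scc_rel
  by (auto simp: component_def cyclic_arcs_def elim: equivE dest: symD transD)

lemma wf_component: "wf_digraph (component G x)"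
  unfolding component_def by (rule wellformed_induce_subgraph)

end

section \<open>The action of a morphism on components\<close>

lemma cyclic_arcs_hom:
  assumes "f \<in> gph_hom X Y" "a \<in> cyclic_arcs X"
  shows "snd f a \<in> cyclic_arcs Y"
  using assms scc_rel_hom[OF assms(1)] gph_homD[OF assms(1)] by (auto simp: cyclic_arcs_def)

lemma gph_restrict_hom:
  assumes X: "wf_digraph X" and Y: "wf_digraph Y" and f: "f \<in> gph_hom X Y"
  shows "gph_restrict f (component X x) \<in> gph_hom (component X x) (component Y (fst f x))"
proof -
  have "tail X a \<in> verts (component X x)" "head X a \<in> verts (component X x)"
    if "a \<in> arcs (component X x)" for a
    using that by (auto simp: component_def)
  moreover have "snd f a \<in> arcs (component Y (fst f x))" if "a \<in> arcs (component X x)" for a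
    using that cyclic_arcs_hom[OF f] scc_rel_hom[OF f] gph_homD(3)[OF f]
    by (auto simp: wf_digraph.arcs_component X Y cyclic_arcs_def)
  moreover have "fst f y \<in> verts (component Y (fst f x))" if "y \<in> verts (component X x)" for y
    using that scc_rel_hom[OF f] by (auto simp: wf_digraph.verts_component X Y)
  moreover have "arcs (component X x) \<subseteq> arcs X" by (auto simp: component_def)
  ultimately show ?thesis
    using gph_homD[OF f] by (auto simp: gph_hom_def gph_restrict_def component_def)
qed

text \<open>Any component containing the image of \<open>component X x\<close> contains
  \<open>fst f x\<close>, and two components with a common node coincide. This replaces the definite
  description by a formula in a representative.\<close>

lemma component_map_component:
  assumes X: "wf_digraph X" and Y: "wf_digraph Y" and f: "f \<in> gph_hom X Y" and x: "x \<in> verts X"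
  shows "component_map Y f (component X x) = component Y (fst f x)"
  unfolding component_map_def
proof (rule the_equality)
  note h = gph_homD[OF gph_restrict_hom[OF X Y f, of x]]
  have "fst f ` verts (component X x) \<subseteq> verts (component Y (fst f x))"
    using h(1) by (auto simp: gph_restrict_def)
  moreover have "snd f ` arcs (component X x) \<subseteq> arcs (component Y (fst f x))"
    using h(2) by (auto simp: gph_restrict_def)
  ultimately show "component Y (fst f x) \<in> strong_components Y \<and>
      fst f ` verts (component X x) \<subseteq> verts (component Y (fst f x)) \<and>
      snd f ` arcs (component X x) \<subseteq> arcs (component Y (fst f x))"
    using gph_homD(1)[OF f x] by (auto simp: wf_digraph.strong_components_eq Y)
next
  fix D
  assume D: "D \<in> strong_components Y \<and> fst f ` verts (component X x) \<subseteq> verts D \<and>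
    snd f ` arcs (component X x) \<subseteq> arcs D"
  then obtain y where y: "y \<in> verts Y" "D = component Y y"
    by (auto simp: wf_digraph.strong_components_eq Y)
  have "x \<in> verts (component X x)"
    using x by (auto simp: wf_digraph.verts_component X scc_rel_iff)
  then have "(y, fst f x) \<in> scc_rel Y"
    using D y by (auto simp: wf_digraph.verts_component Y)
  then show "D = component Y (fst f x)"
    using y wf_digraph.component_eq_iff[OF Y y(1) gph_homD(1)[OF f x]] by simp
qed

section \<open>Consequences of membership in W\<close>

lemma class_W_cycle_lift:
  assumes "f \<in> class_W X Y" "d \<in> gph_hom (cycle_graph n) Y"
  obtains c where "c \<in> gph_hom (cycle_graph n) X" "d = gph_comp (cycle_graph n) f c"
  using assms by (fastforce simp: class_W_def bij_betw_def)

text \<open>The case \<open>n = 0\<close> of the definition of W, transported along the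
  identification of nodes with morphisms \<open>point x\<close>.\<close>

lemma class_W_bij_verts:
  fixes f :: "('a, 'b, 'c, 'd) gph_map"
  assumes "f \<in> class_W X Y"
  shows "bij_betw (fst f) (verts X) (verts Y)"
proof -
  have bij: "bij_betw (gph_comp (cycle_graph 0) f) (point ` verts X) (point ` verts Y)"
    using assms unfolding class_W_def gph_hom_cycle_graph_0[symmetric] by blast
  have "inj_on (fst f) (verts X)"
  proof (rule inj_onI)
    fix x x' assume "x \<in> verts X" "x' \<in> verts X" "fst f x = fst f x'"
    then have "(point x :: (nat, nat, 'a, 'b) gph_map) = point x'"
      by (intro inj_onD[OF bij_betw_imp_inj_on[OF bij]]) (auto simp: gph_comp_point)
    then show "x = x'" by (simp add: point_eq_iff)
  qed
  moreover have "y \<in> fst f ` verts X \<longleftrightarrow> y \<in> verts Y" for y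
  proof -
    have "y \<in> verts Y \<longleftrightarrow> (point y :: (nat, nat, 'c, 'd) gph_map) \<in> point ` verts Y"
      by (auto simp: point_eq_iff)
    also have "\<dots> \<longleftrightarrow> (point y :: (nat, nat, 'c, 'd) gph_map) \<in> gph_comp (cycle_graph 0) f ` point ` verts X"
      using bij by (simp add: bij_betw_def)
    also have "\<dots> \<longleftrightarrow> y \<in> fst f ` verts X"
      by (auto simp: gph_comp_point point_eq_iff image_iff)
    finally show ?thesis by simp
  qed
  ultimately show ?thesis by (auto simp: bij_betw_def)
qed

text \<open>A cycle through the two images lifts to \<open>X\<close>; injectivity on nodes forces
  the lift to pass through \<open>x\<close> and \<open>x'\<close> themselves.\<close>

lemma class_W_reflects_scc_rel:
  assumes W: "f \<in> class_W X Y" and x: "x \<in> verts X" "x' \<in> verts X"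
    and R: "(fst f x, fst f x') \<in> scc_rel Y"
  shows "(x, x') \<in> scc_rel X"
proof -
  have inj: "inj_on (fst f) (verts X)" using class_W_bij_verts[OF W] by (rule bij_betw_imp_inj_on)
  show ?thesis
  proof (cases "fst f x = fst f x'")
    case True
    then show ?thesis using inj_onD[OF inj] x by (simp add: scc_rel_iff)
  next
    case False
    then obtain n d i j where n: "0 < n" and d: "d \<in> gph_hom (cycle_graph n) Y" and
      ij: "i < n" "j < n" "fst f x = fst d i" "fst f x' = fst d j"
      using R by (auto simp: scc_rel_iff)
    obtain c where c: "c \<in> gph_hom (cycle_graph n) X" "d = gph_comp (cycle_graph n) f c"
      using class_W_cycle_lift[OF W d] .
    have "z = fst c k" if "z \<in> verts X" "k < n" "fst f z = fst d k" for z k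
      using that c(2) gph_homD(1)[OF c(1), of k]
      by (intro inj_onD[OF inj]) (auto simp: gph_comp_def compose_def cycle_graph_def)
    then have "x = fst c i" "x' = fst c j" using ij x by auto
    then show ?thesis unfolding scc_rel_iff using x n c(1) ij by blast
  qed
qed

lemma class_W_bij_cyclic_arcs:
  assumes X: "wf_digraph X" and Y: "wf_digraph Y" and W: "f \<in> class_W X Y"
  shows "bij_betw (snd f) (cyclic_arcs X) (cyclic_arcs Y)"
  unfolding bij_betw_def
proof
  have f: "f \<in> gph_hom X Y" using W by (simp add: class_W_def)
  have injV: "inj_on (fst f) (verts X)" using class_W_bij_verts[OF W] by (rule bij_betw_imp_inj_on)
  show "inj_on (snd f) (cyclic_arcs X)"
  proof (rule inj_onI)
    fix a a' assume a: "a \<in> cyclic_arcs X" "a' \<in> cyclic_arcs X" and eq: "snd f a = snd f a'"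
    then have arcs: "a \<in> arcs X" "a' \<in> arcs X" by (auto simp: cyclic_arcs_def)
    have "fst f (tail X a) = fst f (tail X a')" "fst f (head X a) = fst f (head X a')"
      using eq gph_homD(3,4)[OF f arcs(1)] gph_homD(3,4)[OF f arcs(2)] by auto
    then have ends: "tail X a = tail X a'" "head X a = head X a'"
      using inj_onD[OF injV] arcs X by (auto simp: wf_digraph.wellformed)
    obtain n c where n: "0 < n" and c: "c \<in> gph_hom (cycle_graph n) X" "snd c 0 = a"
      using wf_digraph.cyclic_arc_in_cycle[OF X a(1)] .
    \<comment> \<open>The arcs \<open>a\<close> and \<open>a'\<close> have the same ends, so
      exchanging them at index 0 leaves a cycle; since their images agree, \<open>c\<close> and
      \<open>c'\<close> have the same composite with \<open>f\<close>.\<close>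
    define c' where "c' = (fst c, (snd c)(0 := a'))"
    have "c' \<in> gph_hom (cycle_graph n) X"
      using c ends arcs n by (auto simp: c'_def cycle_hom_iff[OF n] PiE_iff extensional_def)
    moreover have "gph_comp (cycle_graph n) f c = gph_comp (cycle_graph n) f c'"
      using c eq n by (auto simp: c'_def gph_comp_def compose_def restrict_def fun_eq_iff)
    moreover have "inj_on (gph_comp (cycle_graph n) f) (gph_hom (cycle_graph n) X)"
      using W by (auto simp: class_W_def bij_betw_def)
    ultimately have "c = c'" using c(1) by (auto dest: inj_onD)
    then have "snd c 0 = snd c' 0" by simp
    then show "a = a'" using c by (simp add: c'_def)
  qed
  show "snd f ` cyclic_arcs X = cyclic_arcs Y"
  proof
    show "snd f ` cyclic_arcs X \<subseteq> cyclic_arcs Y" using cyclic_arcs_hom[OF f] by auto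
    show "cyclic_arcs Y \<subseteq> snd f ` cyclic_arcs X"
    proof
      fix b assume b: "b \<in> cyclic_arcs Y"
      obtain n d where n: "0 < n" and d: "d \<in> gph_hom (cycle_graph n) Y" "snd d 0 = b"
        using wf_digraph.cyclic_arc_in_cycle[OF Y b] .
      obtain c where c: "c \<in> gph_hom (cycle_graph n) X" "d = gph_comp (cycle_graph n) f c"
        using class_W_cycle_lift[OF W d(1)] .
      have "b = snd f (snd c 0)" using c(2) d(2) n by (auto simp: gph_comp_def compose_def cycle_graph_def)
      then show "b \<in> snd f ` cyclic_arcs X"
        using wf_digraph.cycle_hom_cyclic_arcs[OF X c(1) n] by blast
    qed
  qed
qed

section \<open>From bijectivity on nodes and cyclic arcs back to W\<close>

text \<open>All arcs of a cycle are cyclic, so cycles can be compared and lifted position by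
  position.\<close>

lemma class_WI:
  assumes X: "wf_digraph X" and Y: "wf_digraph Y" and f: "f \<in> gph_hom X Y"
    and V: "bij_betw (fst f) (verts X) (verts Y)"
    and A: "bij_betw (snd f) (cyclic_arcs X) (cyclic_arcs Y)"
  shows "f \<in> class_W X Y"
proof -
  have injV: "inj_on (fst f) (verts X)" and injA: "inj_on (snd f) (cyclic_arcs X)"
    using V A by (auto simp: bij_betw_def)
  have "bij_betw (gph_comp (cycle_graph n) f) (gph_hom (cycle_graph n) X) (gph_hom (cycle_graph n) Y)"
    for n
  proof (cases "n = 0")
    case True
    have "bij_betw (gph_comp (cycle_graph 0) f) (point ` verts X) (point ` verts Y)"
      unfolding bij_betw_def
    proof
      show "inj_on (gph_comp (cycle_graph 0) f) (point ` verts X)"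
        using injV by (auto simp: inj_on_def gph_comp_point point_eq_iff)
      show "gph_comp (cycle_graph 0) f ` point ` verts X = point ` verts Y"
        using V by (simp add: image_image gph_comp_point bij_betw_def flip: image_image[of point "fst f"])
    qed
    then show ?thesis using True by (simp add: gph_hom_cycle_graph_0)
  next
    case False
    then have n: "0 < n" by simp
    let ?F = "gph_comp (cycle_graph n) f"
    have fst_F: "fst (?F c) i = fst f (fst c i)" and snd_F: "snd (?F c) i = snd f (snd c i)"
      if "i < n" for c i
      using that by (auto simp: gph_comp_def compose_def cycle_graph_def)
    show ?thesis
      unfolding bij_betw_def
    proof
      show "inj_on ?F (gph_hom (cycle_graph n) X)"
      proof (rule inj_onI)
        fix c c' assume c: "c \<in> gph_hom (cycle_graph n) X" and c': "c' \<in> gph_hom (cycle_graph n) X"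
          and eq: "?F c = ?F c'"
        have "fst c i = fst c' i" if "i < n" for i
          using that fst_F[OF that, of c] fst_F[OF that, of c'] eq c c'
          by (intro inj_onD[OF injV]) (auto simp: cycle_hom_iff[OF n])
        moreover have "snd c i = snd c' i" if "i < n" for i
          using that snd_F[OF that, of c] snd_F[OF that, of c'] eq
            wf_digraph.cycle_hom_cyclic_arcs[OF X c] wf_digraph.cycle_hom_cyclic_arcs[OF X c']
          by (intro inj_onD[OF injA]) auto
        ultimately show "c = c'"
          using c c' by (auto simp: cycle_hom_iff[OF n] intro!: prod_eqI elim!: PiE_ext)
      qed
      show "?F ` gph_hom (cycle_graph n) X = gph_hom (cycle_graph n) Y"
      proof
        show "?F ` gph_hom (cycle_graph n) X \<subseteq> gph_hom (cycle_graph n) Y"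
          using gph_comp_hom[OF wf_cycle_graph _ f] by blast
        show "gph_hom (cycle_graph n) Y \<subseteq> ?F ` gph_hom (cycle_graph n) X"
        proof
          fix d assume d: "d \<in> gph_hom (cycle_graph n) Y"
          \<comment> \<open>Nodes and arcs of \<open>d\<close> are pulled back independently; the
            arcs have preimages because they are cyclic.\<close>
          define c where "c = (\<lambda>i\<in>{..<n}. inv_into (verts X) (fst f) (fst d i),
            \<lambda>i\<in>{..<n}. inv_into (cyclic_arcs X) (snd f) (snd d i))"
          have cV: "fst c i \<in> verts X" "fst f (fst c i) = fst d i" if "i < n" for i
          proof -
            have "fst d i \<in> fst f ` verts X"
              using d V that by (auto simp: cycle_hom_iff[OF n] bij_betw_def)
            then show "fst c i \<in> verts X" "fst f (fst c i) = fst d i"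
              using that by (auto simp: c_def inv_into_into f_inv_into_f)
          qed
          have cA: "snd c i \<in> arcs X" "snd f (snd c i) = snd d i" if "i < n" for i
          proof -
            have *: "snd d i \<in> snd f ` cyclic_arcs X"
              using wf_digraph.cycle_hom_cyclic_arcs[OF Y d that] A by (auto simp: bij_betw_def)
            show "snd f (snd c i) = snd d i"
              using that f_inv_into_f[OF *] by (simp add: c_def)
            show "snd c i \<in> arcs X"
              using that inv_into_into[OF *] by (simp add: c_def cyclic_arcs_def)
          qed
          have "tail X (snd c i) = fst c i \<and> head X (snd c i) = fst c (Suc i mod n)" if i: "i < n" for i
          proof
            have j: "Suc i mod n < n" using n by simp
            \<comment> \<open>The independent choices fit together: the required equalities hold
              after applying \<open>fst f\<close>, which is injective on nodes.\<close>
            have "tail Y (snd d i) = fst d i" "head Y (snd d i) = fst d (Suc i mod n)"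
              using d i by (auto simp: cycle_hom_iff[OF n])
            then have "fst f (tail X (snd c i)) = fst f (fst c i)"
              "fst f (head X (snd c i)) = fst f (fst c (Suc i mod n))"
              using gph_homD(3,4)[OF f cA(1)[OF i]] cA(2)[OF i] cV(2)[OF i] cV(2)[OF j] by auto
            moreover have "tail X (snd c i) \<in> verts X" "head X (snd c i) \<in> verts X"
              using cA(1)[OF i] X by (auto simp: wf_digraph.wellformed)
            ultimately show "tail X (snd c i) = fst c i" "head X (snd c i) = fst c (Suc i mod n)"
              using cV(1)[OF i] cV(1)[OF j] inj_onD[OF injV] by auto
          qed
          then have c: "c \<in> gph_hom (cycle_graph n) X"
            using cV cA by (auto simp: cycle_hom_iff[OF n]) (auto simp: c_def split: if_splits)
          have "?F c \<in> gph_hom (cycle_graph n) Y" using wf_cycle_graph c f by (rule gph_comp_hom)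
          then have "?F c = d"
            using d cV cA fst_F[of _ c] snd_F[of _ c]
            by (auto simp: cycle_hom_iff[OF n] intro!: prod_eqI elim!: PiE_ext)
          then show "d \<in> ?F ` gph_hom (cycle_graph n) X" using c by blast
        qed
      qed
    qed
  qed
  then show ?thesis using f by (simp add: class_W_def)
qed

text \<open>The target \<open>D\<close> must contain \<open>fst f x\<close>, so it can only be
  \<open>component Y (fst f x)\<close>; what remains is bijectivity of the two restricted
  maps.\<close>

lemma gph_iso_gph_restrict_iff:
  assumes X: "wf_digraph X" and Y: "wf_digraph Y" and f: "f \<in> gph_hom X Y" and x: "x \<in> verts X"
  shows "(\<exists>D \<in> strong_components Y. gph_iso (component X x) D (gph_restrict f (component X x))) \<longleftrightarrow>
    bij_betw (fst f) (verts (component X x)) (verts (component Y (fst f x))) \<and>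
    bij_betw (snd f) (arcs (component X x)) (arcs (component Y (fst f x)))"
proof -
  let ?h = "gph_restrict f (component X x)"
  have xin: "x \<in> verts (component X x)"
    using x by (simp add: wf_digraph.verts_component X scc_rel_iff)
  have "D = component Y (fst f x)" if D: "D \<in> strong_components Y" "gph_iso (component X x) D ?h" for D
  proof -
    obtain y where y: "y \<in> verts Y" "D = component Y y"
      using D by (auto simp: wf_digraph.strong_components_eq Y)
    have "fst ?h x \<in> verts D" using D(2) xin by (auto simp: gph_iso_def gph_homD(1))
    then have "(y, fst f x) \<in> scc_rel Y"
      using y xin by (simp add: wf_digraph.verts_component Y gph_restrict_def)
    then show ?thesis
      using y wf_digraph.component_eq_iff[OF Y y(1) gph_homD(1)[OF f x]] by simp
  qed
  moreover have "component Y (fst f x) \<in> strong_components Y"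
    using gph_homD(1)[OF f x] by (simp add: wf_digraph.strong_components_eq Y)
  ultimately have "(\<exists>D \<in> strong_components Y. gph_iso (component X x) D ?h) \<longleftrightarrow>
      gph_iso (component X x) (component Y (fst f x)) ?h"
    by blast
  also have "\<dots> \<longleftrightarrow> bij_betw (fst ?h) (verts (component X x)) (verts (component Y (fst f x))) \<and>
      bij_betw (snd ?h) (arcs (component X x)) (arcs (component Y (fst f x)))"
    by (rule gph_iso_iff[OF wf_digraph.wf_component[OF X] gph_restrict_hom[OF X Y f]])
  finally show ?thesis by (simp add: gph_restrict_def bij_betw_restrict_eq)
qed

section \<open>The equivalence, component by component\<close>

theorem theorem4p1:
  fixes X :: "('a, 'b) pre_digraph" and Y :: "('c, 'd) pre_digraph"
    and f :: "('a, 'b, 'c, 'd) gph_map"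
  assumes "wf_digraph X" and "wf_digraph Y" and "f \<in> gph_hom X Y"
  shows "f \<in> class_W X Y \<longleftrightarrow>
    bij_betw (component_map Y f) (strong_components X) (strong_components Y) \<and>
    (\<forall>C \<in> strong_components X. \<exists>D \<in> strong_components Y. gph_iso C D (gph_restrict f C))"
proof -
  interpret X: wf_digraph X by fact
  interpret Y: wf_digraph Y by fact
  note f = assms(3)
  note fD = gph_homD[OF f]
  note cmap = component_map_component[OF assms]
  have bij_iff: "(\<forall>C \<in> strong_components X. \<exists>D \<in> strong_components Y. gph_iso C D (gph_restrict f C)) \<longleftrightarrow>
      (\<forall>x \<in> verts X. bij_betw (fst f) (verts (component X x)) (verts (component Y (fst f x))) \<and>
         bij_betw (snd f) (arcs (component X x)) (arcs (component Y (fst f x))))"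
    using gph_iso_gph_restrict_iff[OF assms] by (simp add: X.strong_components_eq)
  show ?thesis
    unfolding bij_iff
  proof (intro iffI conjI ballI)
    assume W: "f \<in> class_W X Y"
    have V: "bij_betw (fst f) (verts X) (verts Y)" using W by (rule class_W_bij_verts)
    have A: "bij_betw (snd f) (cyclic_arcs X) (cyclic_arcs Y)"
      using assms(1,2) W by (rule class_W_bij_cyclic_arcs)
    \<comment> \<open>Preserving and reflecting \<open>scc_rel\<close> makes components of
      \<open>X\<close> correspond exactly to components of \<open>Y\<close>.\<close>
    have R: "(fst f x, fst f x') \<in> scc_rel Y \<longleftrightarrow> (x, x') \<in> scc_rel X"
      if "x \<in> verts X" "x' \<in> verts X" for x x'
      using that class_W_reflects_scc_rel[OF W] scc_rel_hom[OF f] by blast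
    show "bij_betw (component_map Y f) (strong_components X) (strong_components Y)"
      unfolding bij_betw_def
    proof
      show "inj_on (component_map Y f) (strong_components X)"
        using fD(1) R
        by (auto simp: inj_on_def X.strong_components_eq cmap X.component_eq_iff Y.component_eq_iff)
      have "verts Y = fst f ` verts X" using V by (simp add: bij_betw_def)
      then show "component_map Y f ` strong_components X = strong_components Y"
        by (simp add: X.strong_components_eq Y.strong_components_eq image_image cmap cong: image_cong)
    qed
    fix x assume x: "x \<in> verts X"
    have "fst f ` verts (component X x) = verts (component Y (fst f x))"
    proof -
      \<comment> \<open>Every node of \<open>Y\<close> is an image, so \<open>R\<close> decides
        which nodes of \<open>X\<close> map into this component.\<close>
      have "verts (component Y (fst f x)) = {y \<in> fst f ` verts X. (fst f x, y) \<in> scc_rel Y}"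
        using V by (auto simp: Y.verts_component bij_betw_def dest: scc_rel_in_verts)
      also have "\<dots> = fst f ` verts (component X x)"
        using R[OF x] by (auto simp: X.verts_component dest: scc_rel_in_verts)
      finally show ?thesis by simp
    qed
    moreover have "verts (component X x) \<subseteq> verts X"
      by (auto simp: X.verts_component dest: scc_rel_in_verts)
    ultimately show "bij_betw (fst f) (verts (component X x)) (verts (component Y (fst f x)))"
      using V by (auto simp: bij_betw_def intro: inj_on_subset)
    have "snd f ` arcs (component X x) = arcs (component Y (fst f x))"
    proof -
      \<comment> \<open>Similarly, every cyclic arc of \<open>Y\<close> is an image, and
        \<open>R\<close> applied to tails sorts these arcs into components.\<close>
      have "arcs (component Y (fst f x)) =
          {b \<in> snd f ` cyclic_arcs X. (fst f x, tail Y b) \<in> scc_rel Y}"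
        using A by (auto simp: Y.arcs_component bij_betw_def)
      also have "\<dots> = snd f ` {a \<in> cyclic_arcs X. (fst f x, fst f (tail X a)) \<in> scc_rel Y}"
        using fD(3) by (auto simp: cyclic_arcs_def)
      also have "\<dots> = snd f ` arcs (component X x)"
        using R[OF x] by (auto simp: X.arcs_component cyclic_arcs_def intro!: imageI)
      finally show ?thesis by simp
    qed
    moreover have "arcs (component X x) \<subseteq> cyclic_arcs X" by (auto simp: X.arcs_component)
    ultimately show "bij_betw (snd f) (arcs (component X x)) (arcs (component Y (fst f x)))"
      using A by (auto simp: bij_betw_def intro: inj_on_subset)
  next
    assume rhs: "bij_betw (component_map Y f) (strong_components X) (strong_components Y) \<and>
      (\<forall>x \<in> verts X. bij_betw (fst f) (verts (component X x)) (verts (component Y (fst f x))) \<and>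
         bij_betw (snd f) (arcs (component X x)) (arcs (component Y (fst f x))))"
    have bijV: "bij_betw (fst f) (verts (component X x)) (verts (component Y (fst f x)))"
      and bijA: "bij_betw (snd f) (arcs (component X x)) (arcs (component Y (fst f x)))"
      if "x \<in> verts X" for x
      using rhs that by auto
    \<comment> \<open>Reflection of \<open>scc_rel\<close> now comes from injectivity of the map on
      components.\<close>
    have R: "(x, x') \<in> scc_rel X" if "x \<in> verts X" "x' \<in> verts X" "(fst f x, fst f x') \<in> scc_rel Y"
      for x x'
    proof -
      have "component_map Y f (component X x) = component_map Y f (component X x')"
        using that fD(1) by (simp add: cmap Y.component_eq_iff)
      then have "component X x = component X x'"
        using rhs that by (auto simp: bij_betw_def X.strong_components_eq dest: inj_onD)
      then show ?thesis using that by (simp add: X.component_eq_iff)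
    qed
    \<comment> \<open>Surjectivity on components: each node of \<open>Y\<close> shares its component
      with some image node.\<close>
    have S: "\<exists>x \<in> verts X. (fst f x, y) \<in> scc_rel Y" if "y \<in> verts Y" for y
    proof -
      have "component Y y \<in> component_map Y f ` component X ` verts X"
        using rhs that by (simp add: bij_betw_def X.strong_components_eq Y.strong_components_eq)
      then obtain x where "x \<in> verts X" "component Y (fst f x) = component Y y"
        by (auto simp: cmap)
      then show ?thesis using that fD(1) by (auto simp: Y.component_eq_iff)
    qed
    have refl: "(x, x) \<in> scc_rel X" if "x \<in> verts X" for x using that by (simp add: scc_rel_iff)
    have reflY: "(y, y) \<in> scc_rel Y" if "y \<in> verts Y" for y using that by (simp add: scc_rel_iff)
    have injV: "inj_on (fst f) (verts X)"
    proof (rule inj_onI)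
      fix x x' assume x: "x \<in> verts X" "x' \<in> verts X" and eq: "fst f x = fst f x'"
      \<comment> \<open>Nodes with equal images lie in one component, where \<open>f\<close> is
        already known to be injective.\<close>
      then have "(x, x') \<in> scc_rel X" using R fD(1) reflY by simp
      then show "x = x'"
        using x eq refl by (intro inj_onD[OF bij_betw_imp_inj_on[OF bijV[OF x(1)]]])
          (auto simp: X.verts_component)
    qed
    have V: "bij_betw (fst f) (verts X) (verts Y)"
      unfolding bij_betw_def
    proof (intro conjI injV equalityI subsetI)
      fix y assume "y \<in> verts Y"
      then obtain x where x: "x \<in> verts X" "(fst f x, y) \<in> scc_rel Y" using S by blast
      then have "y \<in> fst f ` verts (component X x)"
        using bijV[OF x(1)] by (simp add: bij_betw_def Y.verts_component)
      then show "y \<in> fst f ` verts X"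
        by (auto simp: X.verts_component dest: scc_rel_in_verts)
    qed (use fD(1) in auto)
    have A: "bij_betw (snd f) (cyclic_arcs X) (cyclic_arcs Y)"
      unfolding bij_betw_def
    proof (intro conjI inj_onI equalityI subsetI)
      fix a a' assume a: "a \<in> cyclic_arcs X" "a' \<in> cyclic_arcs X" and eq: "snd f a = snd f a'"
      then have arcs: "a \<in> arcs X" "a' \<in> arcs X" by (auto simp: cyclic_arcs_def)
      \<comment> \<open>Equal images force equal tails, so both arcs belong to one component and
        injectivity there applies.\<close>
      then have t: "tail X a = tail X a'"
        using fD(3)[OF arcs(1)] fD(3)[OF arcs(2)] eq injV by (auto dest: inj_onD)
      have v: "tail X a \<in> verts X" using arcs by simp
      show "a = a'"
        using a t eq refl[OF v] by (intro inj_onD[OF bij_betw_imp_inj_on[OF bijA[OF v]]])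
          (auto simp: X.arcs_component)
    next
      fix b assume b: "b \<in> cyclic_arcs Y"
      then have "tail Y b \<in> verts Y" by (auto simp: cyclic_arcs_def)
      then obtain x where x: "x \<in> verts X" "(fst f x, tail Y b) \<in> scc_rel Y" using S by blast
      then have "b \<in> snd f ` arcs (component X x)"
        using b bijA[OF x(1)] by (simp add: bij_betw_def Y.arcs_component)
      then show "b \<in> snd f ` cyclic_arcs X" by (auto simp: X.arcs_component)
    next
      fix b assume "b \<in> snd f ` cyclic_arcs X"
      then show "b \<in> cyclic_arcs Y" using cyclic_arcs_hom[OF f] by auto
    qed
    show "f \<in> class_W X Y" using assms V A by (rule class_WI)
  qed
qed

end
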